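(* Let $\mathbf{k}$ be the field of real numbers or the field of complex numbers, let $A=A_0\oplus A_1$ be a special $\mathcal{Z}_2$-graded Banach algebra over $\mathbf{k}$ with identity $1$, and let $G$ be a linear $\xi$-group in $A$. Then the tangent space $$T_1(G):=\{\,a'(0)\mid a:\mathbb{R}\to G \text{ is a differentiable curve with } a(0)=1\,\}$$ to $G$ at $1$ is a Hu-Liu Leibniz algebra over the field of real numbers with respect to the angle bracket $\langle x,y\rangle:=xy_0-y_0x$ and the square bracket $[x,y]:=xy-yx$ of $A$ (where $y=y_0+y_1$, $y_i\in A_i$); that is, $T_1(G)$ is a real vector subspace of $A$ closed under both brackets, and is a Hu-Liu Leibniz algebra over $\mathbb{R}$ under them.
   Context: An associative algebra $A$ is called a special $\mathcal{Z}_2$-graded associative algebra if $A=A_0\oplus A_1$ as vector spaces and $A_0A_0\subseteq A_0$, $A_0A_1+A_1A_0\subseteq A_1$, and $A_1A_1=0$. A special $\mathcal{Z}_2$-graded Banach algebra over $\mathbf{k}$ is an associative $\mathbf{k}$-algebra that is both a special $\mathcal{Z}_2$-graded associative algebra and a Banach algebra. For $A$ with identity $1$, let $A^{-1}$ denote the group of invertible elements of $A$, and $A_0^{-1}$ the group of invertible elements of $A_0$; then $A^{-1}=\{x_0+x_1\mid x_0\in A_0^{-1},\ x_1\in A_1\}$, and $\xi_{A^{-1}}:x_0+x_1\mapsto x_0$ is an idempotent group endomorphism of $A^{-1}$. A linear $\xi$-group in $A$ is a subgroup $G$ of $A^{-1}$ such that $x_0\,G\,x_0^{-1}\subseteq G$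 for every $x_0+x_1\in G$ with $x_0\in A_0$, $x_1\in A_1$. A differentiable curve $a:\mathbb{R}\to G$ is a map to $G\subseteq A$ that is differentiable as a map into the Banach space $A$. A right Leibniz algebra over a field is a vector space $L$ with a bilinear operation $\langle\,,\,\rangle: L\times L\to L$ satisfying $\langle\langle x,y\rangle,z\rangle=\langle x,\langle y,z\rangle\rangle+\langle\langle x,z\rangle,y\rangle$ for all $x,y,z\in L$. A (right) Hu-Liu Leibniz algebra $(L,+,\langle\,,\,\rangle,[\,,\,])$ is a right Leibniz algebra $(L,+,\langle\,,\,\rangle)$ together with an operation $[\,,\,]:L\times L\to L$ such that $(L,+,[\,,\,])$ is a Lie algebra and, for all $x,y,z\in L$: (1) $\langle x,[y,z]\rangle=\langle x,\langle y,z\rangle\rangle$; (2) $[\langle x,x\rangle,y]=\langle\langle x,x\rangle,y\rangle$; (3) $\langle[x,y],z\rangle+[\langle y,z\rangle,x]+[y,\langle x,z\rangle]=0$; (4) $[\langle x,y\rangle,z]+[z,[x,y]]+[z,\langle y,x\rangle]+\langle z,\langle x,y\rangle\rangle=0$.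
   Formalization: The summands A_0 and A_1 are additionally assumed to be closed in A (equivalently, x ↦ x_0 is continuous); with a purely algebraic direct sum the tangent space need not be closed under the angle bracket, so the statement is false without this. *)

theory Defs
  imports "HOL-Analysis.Analysis" "HOL-Algebra.Group"
begin

text \<open>
  The algebras live on a linear subspace \<open>L\<close> of an ambient vector space; that \<open>L\<close> is a
  subspace closed under the operation is part of the definition.
\<close>

locale algebra_on = vector_space scale
  for scale :: "'k::field \<Rightarrow> 'v::ab_group_add \<Rightarrow> 'v" +
  fixes L :: "'v set" and bra :: "'v \<Rightarrow> 'v \<Rightarrow> 'v"
  assumes subspace_L: "subspace L"
    and closed_bra: "x \<in> L \<Longrightarrow> y \<in> L \<Longrightarrow> bra x y \<in> L"
    and bra_add_left: "x \<in> L \<Longrightarrow> y \<in> L \<Longrightarrow> z \<in> L \<Longrightarrow> bra (x + y) z = bra x z + bra y z"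
    and bra_add_right: "x \<in> L \<Longrightarrow> y \<in> L \<Longrightarrow> z \<in> L \<Longrightarrow> bra x (y + z) = bra x y + bra x z"
    and bra_scale_left: "x \<in> L \<Longrightarrow> y \<in> L \<Longrightarrow> bra (scale c x) y = scale c (bra x y)"
    and bra_scale_right: "x \<in> L \<Longrightarrow> y \<in> L \<Longrightarrow> bra x (scale c y) = scale c (bra x y)"

locale right_leibniz_algebra_on = algebra_on scale L ang
  for scale :: "'k::field \<Rightarrow> 'v::ab_group_add \<Rightarrow> 'v" and L and ang +
  assumes right_leibniz:
    "x \<in> L \<Longrightarrow> y \<in> L \<Longrightarrow> z \<in> L \<Longrightarrow> ang (ang x y) z = ang x (ang y z) + ang (ang x z) y"

locale lie_algebra_on = algebra_on scale L sq
  for scale :: "'k::field \<Rightarrow> 'v::ab_group_add \<Rightarrow> 'v" and L and sq +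
  assumes alternating: "x \<in> L \<Longrightarrow> sq x x = 0"
    and jacobi:
      "x \<in> L \<Longrightarrow> y \<in> L \<Longrightarrow> z \<in> L \<Longrightarrow> sq (sq x y) z + sq (sq y z) x + sq (sq z x) y = 0"

locale hu_liu_leibniz_algebra_on =
  right_leibniz_algebra_on scale L ang + lie_algebra_on scale L sq
  for scale :: "'k::field \<Rightarrow> 'v::ab_group_add \<Rightarrow> 'v" and L and ang and sq +
  assumes hu_liu_1: "x \<in> L \<Longrightarrow> y \<in> L \<Longrightarrow> z \<in> L \<Longrightarrow> ang x (sq y z) = ang x (ang y z)"
    and hu_liu_2: "x \<in> L \<Longrightarrow> y \<in> L \<Longrightarrow> sq (ang x x) y = ang (ang x x) y"
    and hu_liu_3: "x \<in> L \<Longrightarrow> y \<in> L \<Longrightarrow> z \<in> L \<Longrightarrow>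
      ang (sq x y) z + sq (ang y z) x + sq y (ang x z) = 0"
    and hu_liu_4: "x \<in> L \<Longrightarrow> y \<in> L \<Longrightarrow> z \<in> L \<Longrightarrow>
      sq (ang x y) z + sq z (sq x y) + sq z (ang y x) + ang z (ang x y) = 0"

locale special_graded_algebra = vector_space scale
  for scale :: "'k::field \<Rightarrow> 'a::ring \<Rightarrow> 'a" +
  fixes A0 A1 :: "'a set"
  assumes scale_mult_left: "scale c x * y = scale c (x * y)"
    and scale_mult_right: "x * scale c y = scale c (x * y)"
    and subspace_A0: "subspace A0"
    and subspace_A1: "subspace A1"
    and sum_A0_A1: "\<exists>x0\<in>A0. \<exists>x1\<in>A1. x = x0 + x1"
    and int_A0_A1: "A0 \<inter> A1 = {0}"
    and A0_A0: "x \<in> A0 \<Longrightarrow> y \<in> A0 \<Longrightarrow> x * y \<in> A0"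
    and A0_A1: "x \<in> A0 \<Longrightarrow> y \<in> A1 \<Longrightarrow> x * y \<in> A1"
    and A1_A0: "x \<in> A1 \<Longrightarrow> y \<in> A0 \<Longrightarrow> x * y \<in> A1"
    and A1_A1: "x \<in> A1 \<Longrightarrow> y \<in> A1 \<Longrightarrow> x * y = 0"

text \<open>
  A Banach algebra over \<open>'k\<close> is a real Banach algebra (the type class part) with a compatible
  scalar multiplication by \<open>'k\<close>. The norm of the identity is not required to be 1, which is why
  the sort uses \<^class>\<open>monoid_mult\<close> and not \<^class>\<open>real_normed_algebra_1\<close>.

  The decomposition into \<open>A0\<close> and \<open>A1\<close> is understood as a direct sum of Banach spaces, so the
  homogeneous components are closed. With a purely algebraic direct sum the tangent space need
  not be closed under the angle bracket. Let \<open>A\<close> consist of the upper triangular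
  matrices \<open>(p, w; 0, q)\<close> with \<open>p, q\<close> scalars and \<open>w\<close> in the Banach space \<open>W = l2 \<oplus> k e\<close>,
  under the norm \<open>|p| + |w| + |q|\<close>. Let \<open>f\<close> be a discontinuous functional
  on \<open>l2\<close> that vanishes on the finitely supported sequences \<open>c00\<close>, and
  let \<open>A1 = {(0, t e; 0, 0)}\<close> and \<open>A0 = {(p, u + f(u) e; 0, q) | u in l2}\<close>.
  The group \<open>G = {(p, w; 0, 1) | p > 0 real, w in c00}\<close> lies in \<open>A0\<close>, and its tangent space at 1
  is \<open>{(r, u; 0, 0) | r real, u in l2}\<close>. For \<open>x = (1, 0; 0, 0)\<close> and \<open>y = (0, u; 0, 0)\<close>
  with \<open>f(u) \<noteq> 0\<close> the angle bracket is \<open>(0, u + f(u) e; 0, 0)\<close>, which is not tangent to \<open>G\<close>.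
\<close>

locale special_graded_banach_algebra = special_graded_algebra scale A0 A1
  for scale :: "'k::real_normed_field \<Rightarrow> 'a::{real_normed_algebra,monoid_mult,banach} \<Rightarrow> 'a"
    and A0 A1 :: "'a set" +
  assumes norm_scale: "norm (scale c x) = norm c * norm x"
    and scale_of_real: "scale (of_real r) x = r *\<^sub>R x"
    and closed_A0: "closed A0"
    and closed_A1: "closed A1"

definition even_part :: "'a::ring set \<Rightarrow> 'a set \<Rightarrow> 'a \<Rightarrow> 'a" where
  "even_part A0 A1 x = (THE x0. x0 \<in> A0 \<and> (\<exists>x1\<in>A1. x = x0 + x1))"

definition angle_bracket :: "'a::ring set \<Rightarrow> 'a set \<Rightarrow> 'a \<Rightarrow> 'a \<Rightarrow> 'a" where
  "angle_bracket A0 A1 x y = x * even_part A0 A1 y - even_part A0 A1 y * x"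

definition square_bracket :: "'a::ring \<Rightarrow> 'a \<Rightarrow> 'a" where
  "square_bracket x y = x * y - y * x"

definition inv_group :: "'a::monoid_mult monoid" where
  "inv_group = units_of \<lparr>carrier = UNIV, monoid.mult = (*), one = 1\<rparr>"

definition linear_xi_group :: "'a::{ring,monoid_mult} set \<Rightarrow> 'a set \<Rightarrow> 'a set \<Rightarrow> bool" where
  "linear_xi_group A0 A1 G \<longleftrightarrow>
     subgroup G inv_group \<and>
     (\<forall>x0\<in>A0. \<forall>x1\<in>A1. x0 + x1 \<in> G \<longrightarrow> (\<lambda>g. x0 * g * m_inv inv_group x0) ` G \<subseteq> G)"

definition tangent_space_1 :: "'a::{real_normed_algebra,monoid_mult} set \<Rightarrow> 'a set" where
  "tangent_space_1 G =
     {vector_derivative a (at 0) |a :: real \<Rightarrow> 'a.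
        range a \<subseteq> G \<and> (\<forall>t. a differentiable (at t)) \<and> a 0 = 1}"

end

theory Submission
  imports Defs
begin

text \<open>
  The bracket identities hold in the whole algebra \<open>A\<close>. They follow from associativity once one
  knows that the even part is multiplicative and that an element \<open>w\<close> with even part 0 satisfies
  \<open>w y = w y0\<close> and \<open>y w = y0 w\<close>, both consequences of \<open>A1 A1 = 0\<close>. What remains is that
  the tangent space is a real subspace closed under both brackets. It is a subspace because the
  curves \<open>a(t) b(t)\<close> and \<open>a(c t)\<close> realise sums and multiples.

  For the brackets, the usual argument differentiates \<open>a(s) y a(s)\<inverse>\<close> at \<open>s = 0\<close>. That exhibits
  \<open>[x, y]\<close> only as a limit of tangent vectors, which settles nothing unless the tangent space is
  known to be closed. Instead one writes down a curve in \<open>G\<close> with the required velocity. If \<open>u\<close>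
  and \<open>v\<close> are curves of invertible elements through 1 with velocities \<open>x\<close> and \<open>y\<close>, their group commutator is
  \<open>1 + s\<^sup>2 [x, y] + o(s\<^sup>2)\<close> (lemma \<open>commutator_second_order\<close>), so substituting \<open>s = sqrt t\<close> gives
  right derivative \<open>[x, y]\<close> at 0. The inverse commutator at \<open>s = sqrt (- t)\<close> continues the curve
  to negative \<open>t\<close> with the same left derivative (lemma \<open>tangent_square_root_reparametrisation\<close>).
  The resulting curve is differentiable everywhere, which is all that the tangent space asks of it.

  The square bracket uses \<open>u = a\<close>, \<open>v = b\<close> for curves in \<open>G\<close>. The angle bracket uses \<open>u = a\<close> and
  the even part \<open>v = b0\<close> of \<open>b\<close>. Although \<open>b0\<close> may leave \<open>G\<close>, the commutator
  \<open>a (b0 a\<inverse> b0\<inverse>)\<close> lies in \<open>G\<close> because a linear \<open>\<xi>\<close>-group is stable under conjugation by \<open>b0\<close>.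
  Differentiability of \<open>b0\<close> needs a bounded projection onto \<open>A0\<close>. This is the closed graph
  theorem, derived below from the Baire category theorem.
\<close>

section \<open>The closed graph theorem\<close>

lemma baire_cover_closure:
  fixes S :: "nat \<Rightarrow> 'a::banach set"
  assumes "(\<Union>n. S n) = UNIV"
  shows "\<exists>n z e. e > 0 \<and> ball z e \<subseteq> closure (S n)"
proof (rule ccontr)
  assume no_ball: "\<not> ?thesis"
  have empty_interior: "interior (closure (S n)) = {}" for n
    using no_ball by (auto simp: set_eq_iff mem_interior)
  have "Met_TC.mtopology interior_of (\<Union>(range (\<lambda>n. closure (S n)))) = {}"
  proof (rule Met_TC.metric_Baire_category_alt)
    show "Met_TC.mcomplete TYPE('a)"
      by (simp add: complete_UNIV)
    show "countable (range (\<lambda>n. closure (S n)))"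
      by simp
    show "closedin Met_TC.mtopology T \<and> Met_TC.mtopology interior_of T = {}"
      if "T \<in> range (\<lambda>n. closure (S n))" for T
      using that empty_interior by auto
  qed
  moreover have "\<Union>(range (\<lambda>n. closure (S n))) = UNIV"
    using assms closure_subset by blast
  ultimately show False
    by simp
qed

text \<open>
  The sets on which \<open>norm (f x)\<close> is at most \<open>n\<close> cover the space, so one of them is dense in a ball
  around some \<open>z\<close>. Differences of its points are dense in the ball around 0 and satisfy the bound
  \<open>2 n\<close>, and rescaling reaches every vector.
\<close>
lemma baire_approximate_preimage:
  fixes f :: "'a::banach \<Rightarrow> 'b::real_normed_vector"
  assumes "linear f"
  shows "\<exists>K\<ge>0. \<forall>x. \<forall>d>0. \<exists>y. norm (x - y) \<le> d \<and> norm (f y) \<le> K * norm x"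
proof -
  interpret f: linear f by fact
  define S where "S n = {x. norm (f x) \<le> real n}" for n
  have "(\<Union>n. S n) = UNIV"
    using real_nat_ceiling_ge unfolding S_def by blast
  from baire_cover_closure[OF this]
  obtain n z e where e: "e > 0" and ball: "ball z e \<subseteq> closure (S n)"
    by blast
  have small: "\<exists>y. norm (u - y) \<le> d \<and> norm (f y) \<le> 2 * real n"
    if "norm u < e" "d > 0" for u d
  proof -
    have "z \<in> closure (S n)" "z + u \<in> closure (S n)"
      using ball e that by (auto simp: subset_iff dist_norm)
    then obtain p q where p: "p \<in> S n" "dist p z < d / 2" and q: "q \<in> S n" "dist q (z + u) < d / 2"
      using \<open>d > 0\<close> by (meson closure_approachable half_gt_zero)
    have "norm (u - (q - p)) = norm ((p - z) - (q - (z + u)))"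
      by (simp add: algebra_simps)
    also have "\<dots> \<le> d"
      using p(2) q(2) norm_triangle_ineq4[of "p - z" "q - (z + u)"] by (simp add: dist_norm)
    finally have "norm (u - (q - p)) \<le> d" .
    moreover have "norm (f (q - p)) \<le> 2 * real n"
      using p(1) q(1) norm_triangle_ineq4[of "f q" "f p"] by (simp add: S_def f.diff)
    ultimately show ?thesis by blast
  qed
  define K where "K = 4 * real n / e"
  have "\<exists>y. norm (x - y) \<le> d \<and> norm (f y) \<le> K * norm x" if d: "d > 0" for x d
  proof (cases "x = 0")
    case True
    then show ?thesis using d by (intro exI[of _ 0]) simp
  next
    case False
    \<comment> \<open>Chosen so that \<open>c x\<close> has norm \<open>e / 2\<close>, inside the ball where approximants exist.\<close>
    define c where "c = e / (2 * norm x)"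
    have c: "c > 0" using e False by (simp add: c_def)
    have "norm (c *\<^sub>R x) < e"
      using e False by (simp add: c_def)
    from small[OF this, of "c * d"] obtain y
      where y: "norm (c *\<^sub>R x - y) \<le> c * d" "norm (f y) \<le> 2 * real n"
      using c d by auto
    have "norm (x - y /\<^sub>R c) = norm (c *\<^sub>R x - y) / c"
    proof -
      have "x - y /\<^sub>R c = (c *\<^sub>R x - y) /\<^sub>R c"
        using c by (simp add: scaleR_right_diff_distrib)
      then show ?thesis
        using c by (simp add: divide_inverse_commute)
    qed
    then have "norm (x - y /\<^sub>R c) \<le> d"
      using y(1) c by (simp add: pos_divide_le_eq mult.commute)
    moreover have "norm (f (y /\<^sub>R c)) \<le> K * norm x"
      using y(2) c e False by (simp add: f.scaleR K_def c_def field_simps)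
    ultimately show ?thesis by blast
  qed
  moreover have "K \<ge> 0" using e by (simp add: K_def)
  ultimately show ?thesis by blast
qed

text \<open>
  Approximating \<open>x\<close>, then the remainder, and so on with errors halving each time writes \<open>x\<close> as a
  series whose images are dominated by a geometric series. The closed graph identifies the sum of
  the images with \<open>f x\<close>.
\<close>
theorem closed_graph_bounded_linear:
  fixes f :: "'a::banach \<Rightarrow> 'b::banach"
  assumes lin: "linear f"
    and closed_graph: "\<And>u x y. u \<longlonglongrightarrow> x \<Longrightarrow> (\<lambda>n. f (u n)) \<longlonglongrightarrow> y \<Longrightarrow> f x = y"
  shows "bounded_linear f"
proof -
  interpret f: linear f by fact
  obtain K where K: "K \<ge> 0"
    and "\<forall>x. \<forall>d>0. \<exists>y. norm (x - y) \<le> d \<and> norm (f y) \<le> K * norm x"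
    using baire_approximate_preimage[OF lin] by blast
  then obtain Y where Y: "\<And>x d. d > 0 \<Longrightarrow> norm (x - Y x d) \<le> d \<and> norm (f (Y x d)) \<le> K * norm x"
    by metis
  have "norm (f x) \<le> norm x * (2 * K)" for x
  proof (cases "x = 0")
    case False
    define r where "r = rec_nat x (\<lambda>k s. s - Y s (norm x * (1/2) ^ Suc k))"
    define y where "y k = Y (r k) (norm x * (1/2) ^ Suc k)" for k
    have r_Suc: "r (Suc k) = r k - y k" for k by (simp add: r_def y_def)
    have r_0: "r 0 = x" by (simp add: r_def)
    have pos: "norm x * (1/2) ^ Suc k > 0" for k using False by simp
    have r_bound: "norm (r k) \<le> norm x * (1/2) ^ k" for k
    proof (cases k)
      case 0 then show ?thesis by (simp add: r_0)
    next
      case (Suc j)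
      then show ?thesis using Y[OF pos, of "r j" j] by (simp add: r_Suc y_def)
    qed
    have fy_bound: "norm (f (y k)) \<le> K * norm x * (1/2) ^ k" for k
    proof -
      have "norm (f (y k)) \<le> K * norm (r k)"
        unfolding y_def using Y[OF pos] by blast
      also have "\<dots> \<le> K * (norm x * (1/2) ^ k)"
        using r_bound K by (rule mult_left_mono)
      finally show ?thesis by (simp add: mult.assoc)
    qed
    have geo: "(\<lambda>k. K * norm x * (1/2) ^ k) sums (K * norm x * 2)"
      using sums_mult[OF geometric_sums[of "1/2 :: real"], of "K * norm x"] by simp
    have sum_y: "(\<Sum>k<m. y k) = x - r m" for m
      by (induction m) (simp_all add: r_0 r_Suc)
    have "(\<lambda>k. norm x * (1/2) ^ k) \<longlonglongrightarrow> norm x * 0"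
      using tendsto_mult[OF tendsto_const LIMSEQ_power_zero[of "1/2 :: real"], of "norm x"] by simp
    then have "(\<lambda>k. norm x * (1/2) ^ k) \<longlonglongrightarrow> 0"
      by simp
    with always_eventually[OF allI[OF r_bound]] have r: "r \<longlonglongrightarrow> 0"
      by (rule Lim_null_comparison)
    have "(\<lambda>m. \<Sum>k<m. y k) \<longlonglongrightarrow> x - 0"
      unfolding sum_y by (rule tendsto_diff[OF tendsto_const r])
    moreover have "summable (\<lambda>k. f (y k))"
      by (rule summable_comparison_test'[OF sums_summable[OF geo], where N = 0]) (rule fy_bound)
    then have "(\<lambda>m. f (\<Sum>k<m. y k)) \<longlonglongrightarrow> (\<Sum>k. f (y k))"
      by (simp add: f.sum summable_LIMSEQ)
    ultimately have "f x = (\<Sum>k. f (y k))"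
      using closed_graph by auto
    then have "norm (f x) \<le> (\<Sum>k. K * norm x * (1/2) ^ k)"
      using norm_suminf_le[OF fy_bound sums_summable[OF geo]] by simp
    also have "\<dots> = norm x * (2 * K)"
      using geo by (simp add: sums_iff)
    finally show ?thesis .
  qed simp
  then show ?thesis
    by (intro bounded_linear_intro[where K = "2 * K"]) (auto simp: f.add f.scaleR)
qed

section \<open>The even part\<close>

context special_graded_algebra
begin

abbreviation ev :: "'a \<Rightarrow> 'a" where
  "ev \<equiv> even_part A0 A1"

lemma even_part_unique:
  assumes "a0 \<in> A0" "a1 \<in> A1" "b0 \<in> A0" "b1 \<in> A1" "a0 + a1 = b0 + b1"
  shows "a0 = b0"
proof -
  have "a0 - b0 = (a0 + a1) - b0 - a1"
    by (simp add: algebra_simps)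
  then have "a0 - b0 = b1 - a1"
    unfolding assms(5) by simp
  moreover have "a0 - b0 \<in> A0"
    by (rule subspace_diff[OF subspace_A0 assms(1,3)])
  moreover have "b1 - a1 \<in> A1"
    by (rule subspace_diff[OF subspace_A1 assms(4,2)])
  ultimately have "a0 - b0 \<in> A0 \<inter> A1"
    by simp
  then show ?thesis
    unfolding int_A0_A1 by simp
qed

lemma even_part_eqI:
  assumes "x0 \<in> A0" "x1 \<in> A1" "x = x0 + x1"
  shows "ev x = x0"
  unfolding even_part_def
proof (rule the_equality)
  show "x0 \<in> A0 \<and> (\<exists>x1\<in>A1. x = x0 + x1)"
    using assms by blast
  fix y assume "y \<in> A0 \<and> (\<exists>x1\<in>A1. x = y + x1)"
  then obtain y1 where "y \<in> A0" "y1 \<in> A1" "x = y + y1"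
    by blast
  then show "y = x0"
    using even_part_unique[of y y1 x0 x1] assms by metis
qed

lemma even_part_in: "ev x \<in> A0"
  and odd_part_in: "x - ev x \<in> A1"
proof -
  obtain x0 x1 where x: "x0 \<in> A0" "x1 \<in> A1" "x = x0 + x1"
    using sum_A0_A1[of x] by blast
  have "ev x = x0" "x - x0 = x1"
    using even_part_eqI[OF x] x(3) by simp_all
  then show "ev x \<in> A0" "x - ev x \<in> A1"
    using x(1,2) by simp_all
qed

lemma even_part_of_even: "x \<in> A0 \<Longrightarrow> ev x = x"
  using even_part_eqI[of x 0 x] subspace_0[OF subspace_A1] by simp

lemma even_part_idem [simp]: "ev (ev x) = ev x"
  by (simp add: even_part_in even_part_of_even)

lemma even_part_add: "ev (x + y) = ev x + ev y"
proof (rule even_part_eqI)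
  show "ev x + ev y \<in> A0"
    by (rule subspace_add[OF subspace_A0 even_part_in even_part_in])
  show "(x - ev x) + (y - ev y) \<in> A1"
    by (rule subspace_add[OF subspace_A1 odd_part_in odd_part_in])
qed simp

lemma even_part_diff: "ev (x - y) = ev x - ev y"
proof (rule even_part_eqI)
  show "ev x - ev y \<in> A0"
    by (rule subspace_diff[OF subspace_A0 even_part_in even_part_in])
  show "(x - ev x) - (y - ev y) \<in> A1"
    by (rule subspace_diff[OF subspace_A1 odd_part_in odd_part_in])
qed simp

lemma even_part_scale: "ev (scale c x) = scale c (ev x)"
proof (rule even_part_eqI)
  show "scale c (ev x) \<in> A0"
    by (rule subspace_scale[OF subspace_A0 even_part_in])
  show "scale c (x - ev x) \<in> A1"
    by (rule subspace_scale[OF subspace_A1 odd_part_in])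
qed (simp add: scale_right_diff_distrib)

lemma odd_mult_odd: "(x - ev x) * (y - ev y) = 0"
  by (simp add: A1_A1 odd_part_in)

lemma even_part_mult: "ev (x * y) = ev x * ev y"
proof (rule even_part_eqI)
  show "ev x * (y - ev y) + (x - ev x) * ev y \<in> A1"
    by (rule subspace_add[OF subspace_A1 A0_A1[OF even_part_in odd_part_in] A1_A0[OF odd_part_in even_part_in]])
  show "x * y = ev x * ev y + (ev x * (y - ev y) + (x - ev x) * ev y)"
    using odd_mult_odd[of x y] by (simp add: algebra_simps)
qed (simp add: A0_A0 even_part_in)

text \<open>
  An odd factor annihilates the odd part of its partner. This is what turns square brackets into
  angle brackets in the identities below.
\<close>
lemma odd_mult:
  assumes "ev w = 0"
  shows "w * y = w * ev y" "y * w = ev y * w"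
  using odd_mult_odd[of w y] odd_mult_odd[of y w] assms by (simp_all add: algebra_simps)

end

text \<open>
  Closedness of both summands makes the graph of the projection closed: if \<open>u n\<close> tends to \<open>x\<close> and
  its even parts tend to \<open>y\<close>, then \<open>y\<close> is even and \<open>x - y\<close> is odd.
\<close>
lemma (in special_graded_banach_algebra) bounded_linear_even_part: "bounded_linear ev"
proof (rule closed_graph_bounded_linear)
  show "linear ev"
  proof (rule linearI)
    show "ev (r *\<^sub>R x) = r *\<^sub>R ev x" for r x
      using even_part_scale[of "of_real r" x] by (simp only: scale_of_real)
  qed (rule even_part_add)
next
  fix u x y
  assume u: "u \<longlonglongrightarrow> x" and ev: "(\<lambda>n. ev (u n)) \<longlonglongrightarrow> y"
  have "y \<in> A0"
    using closed_sequentially[OF closed_A0 _ ev] even_part_in by blast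
  moreover have "x - y \<in> A1"
    using closed_sequentially[OF closed_A1 _ tendsto_diff[OF u ev]] odd_part_in by blast
  ultimately show "ev x = y"
    by (intro even_part_eqI) auto
qed

section \<open>The bracket identities\<close>

context special_graded_algebra
begin

lemma angle_right_leibniz:
  "angle_bracket A0 A1 (angle_bracket A0 A1 x y) z =
   angle_bracket A0 A1 x (angle_bracket A0 A1 y z) + angle_bracket A0 A1 (angle_bracket A0 A1 x z) y"
  by (simp add: angle_bracket_def even_part_diff even_part_mult algebra_simps)

lemma angle_square:
  "angle_bracket A0 A1 x (square_bracket y z) = angle_bracket A0 A1 x (angle_bracket A0 A1 y z)"
  by (simp add: angle_bracket_def square_bracket_def even_part_diff even_part_mult)

lemma square_angle_self:
  "square_bracket (angle_bracket A0 A1 x x) y = angle_bracket A0 A1 (angle_bracket A0 A1 x x) y"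
proof -
  have "ev (angle_bracket A0 A1 x x) = 0"
    by (simp add: angle_bracket_def even_part_diff even_part_mult)
  from odd_mult[OF this, of y] show ?thesis
    by (simp add: square_bracket_def angle_bracket_def[of A0 A1 "angle_bracket A0 A1 x x"])
qed

lemma angle_derivation_square:
  "angle_bracket A0 A1 (square_bracket x y) z + square_bracket (angle_bracket A0 A1 y z) x
   + square_bracket y (angle_bracket A0 A1 x z) = 0"
  by (simp add: angle_bracket_def square_bracket_def algebra_simps)

text \<open>
  Writing \<open>w = \<langle>x, y\<rangle>\<close>, vanishing of the odd-odd products gives \<open>[x, y] + \<langle>y, x\<rangle> = w - w0\<close>. The
  four terms then add up to \<open>[w, z] + [z, w - w0] + [z, w0]\<close>, which is zero.
\<close>
lemma square_angle_mixed:
  "square_bracket (angle_bracket A0 A1 x y) z + square_bracket z (square_bracket x y)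
   + square_bracket z (angle_bracket A0 A1 y x) + angle_bracket A0 A1 z (angle_bracket A0 A1 x y) = 0"
proof -
  have products: "x * y = x * ev y + ev x * y - ev x * ev y" "y * x = y * ev x + ev y * x - ev y * ev x"
    using odd_mult_odd[of x y] odd_mult_odd[of y x] by (simp_all add: algebra_simps)
  have "square_bracket x y + angle_bracket A0 A1 y x = angle_bracket A0 A1 x y - ev (angle_bracket A0 A1 x y)"
    by (simp add: square_bracket_def angle_bracket_def even_part_diff even_part_mult products)
  then have "square_bracket x y = angle_bracket A0 A1 x y - ev (angle_bracket A0 A1 x y) - angle_bracket A0 A1 y x"
    by (simp add: eq_diff_eq)
  moreover have "square_bracket w z + square_bracket z s + square_bracket z t + angle_bracket A0 A1 z w = 0"
    if "s = w - ev w - t" for s t w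
    unfolding that square_bracket_def angle_bracket_def by (simp add: algebra_simps)
  ultimately show ?thesis
    by blast
qed

end

section \<open>Invertible curves\<close>

lemma has_vector_derivative_iff_quotient:
  fixes f :: "real \<Rightarrow> 'a::real_normed_vector"
  shows "(f has_vector_derivative D) (at t) \<longleftrightarrow> ((\<lambda>s. (f s - f t) /\<^sub>R (s - t)) \<longlongrightarrow> D) (at t)"
proof -
  have eq: "norm ((f s - f t) - (s - t) *\<^sub>R D) / norm (s - t) = norm ((f s - f t) /\<^sub>R (s - t) - D)"
    if "s \<noteq> t" for s
  proof -
    have "(f s - f t) /\<^sub>R (s - t) - D = ((f s - f t) - (s - t) *\<^sub>R D) /\<^sub>R (s - t)"
      using that by (simp add: scaleR_right_diff_distrib)
    then show ?thesis by (simp add: divide_inverse_commute)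
  qed
  have "(f has_vector_derivative D) (at t) \<longleftrightarrow>
      ((\<lambda>s. norm ((f s - f t) - (s - t) *\<^sub>R D) / norm (s - t)) \<longlongrightarrow> 0) (at t)"
    by (simp add: has_vector_derivative_def has_derivative_iff_norm bounded_linear_scaleR_left)
  also have "\<dots> \<longleftrightarrow> ((\<lambda>s. norm ((f s - f t) /\<^sub>R (s - t) - D)) \<longlongrightarrow> 0) (at t)"
    by (intro filterlim_cong refl) (simp add: eventually_at_filter eq[simplified])
  finally show ?thesis
    by (simp add: tendsto_norm_zero_iff LIM_zero_iff)
qed

text \<open>
  Continuity of inversion, from \<open>v s - v t = v s (u t - u s) v t\<close>. Once \<open>norm (u t - u s) * norm (v t)\<close>
  is at most \<open>1/2\<close>, this identity bounds \<open>norm (v s)\<close> by \<open>2 * norm (v t)\<close>, and the same identity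
  then forces convergence.
\<close>
lemma isCont_inverse_curve:
  fixes u v :: "real \<Rightarrow> 'a::{real_normed_algebra,monoid_mult}"
  assumes cont: "isCont u t" and inv: "\<And>s. u s * v s = 1" "\<And>s. v s * u s = 1"
  shows "isCont v t"
proof -
  have diff_eq: "v s - v t = v s * (u t - u s) * v t" for s
    by (simp add: right_diff_distrib left_diff_distrib inv mult.assoc)
  have lim: "((\<lambda>s. norm (u t - u s) * norm (v t)) \<longlongrightarrow> 0) (at t)"
    using cont unfolding isCont_def by (auto intro!: tendsto_eq_intros)
  have bound: "\<forall>\<^sub>F s in at t. norm (v s - v t) \<le> 2 * norm (v t) * (norm (u t - u s) * norm (v t))"
    using order_tendstoD(2)[OF lim, of "1/2", simplified]
  proof eventually_elim
    case (elim s)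
    define q where "q = norm (u t - u s) * norm (v t)"
    have "norm (v s - v t) \<le> norm (v s * (u t - u s)) * norm (v t)"
      unfolding diff_eq by (rule norm_mult_ineq)
    also have "\<dots> \<le> norm (v s) * norm (u t - u s) * norm (v t)"
      by (intro mult_right_mono norm_mult_ineq) simp
    finally have *: "norm (v s - v t) \<le> norm (v s) * q"
      by (simp add: q_def mult.assoc)
    have q: "q \<ge> 0" "q \<le> 1/2" using elim by (simp_all add: q_def)
    have "norm (v s) \<le> norm (v t) + norm (v s - v t)"
      using norm_triangle_sub[of "v s" "v t"] by simp
    also have "\<dots> \<le> norm (v t) + norm (v s) * (1/2)"
      using * mult_left_mono[OF q(2), of "norm (v s)"] by simp
    finally have "norm (v s) \<le> 2 * norm (v t)" by simp
    then have "norm (v s) * q \<le> 2 * norm (v t) * q"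
      using q(1) by (rule mult_right_mono)
    with * show ?case by (simp add: q_def)
  qed
  have "((\<lambda>s. 2 * norm (v t) * (norm (u t - u s) * norm (v t))) \<longlongrightarrow> 0) (at t)"
    using tendsto_mult[OF tendsto_const lim] by simp
  with bound have "((\<lambda>s. v s - v t) \<longlongrightarrow> 0) (at t)"
    by (rule Lim_null_comparison)
  then show ?thesis
    by (simp add: isCont_def LIM_zero_iff)
qed

lemma differentiable_inverse_curve:
  fixes u v :: "real \<Rightarrow> 'a::{real_normed_algebra,monoid_mult}"
  assumes diff: "u differentiable (at t)" and inv: "\<And>s. u s * v s = 1" "\<And>s. v s * u s = 1"
  shows "v differentiable (at t)"
proof -
  obtain D where D: "(u has_vector_derivative D) (at t)"
    using diff by (auto simp: vector_derivative_works)
  have "isCont u t"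
    using D by (rule has_vector_derivative_continuous)
  then have cont: "v \<midarrow>t\<rightarrow> v t"
    using isCont_inverse_curve[OF _ inv] by (simp add: isCont_def)
  have "(v s - v t) /\<^sub>R (s - t) = - (v s * ((u s - u t) /\<^sub>R (s - t)) * v t)" for s
  proof -
    have "v s - v t = - (v s * (u s - u t) * v t)"
      by (simp add: right_diff_distrib left_diff_distrib inv mult.assoc)
    then show ?thesis by simp
  qed
  moreover have "((\<lambda>s. - (v s * ((u s - u t) /\<^sub>R (s - t)) * v t)) \<longlongrightarrow> - (v t * D * v t)) (at t)"
    using D cont unfolding has_vector_derivative_iff_quotient by (intro tendsto_intros)
  ultimately have "(v has_vector_derivative - (v t * D * v t)) (at t)"
    by (simp add: has_vector_derivative_iff_quotient)
  then show ?thesis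
    by (rule differentiableI_vector)
qed

text \<open>
  The inverses form an explicit second curve \<open>u'\<close> because the elements \<open>u t\<close> are not taken from a
  particular group: even parts of curves in \<open>G\<close> also have to qualify.
\<close>
definition invertible_curve ::
    "(real \<Rightarrow> 'a::{real_normed_algebra,monoid_mult}) \<Rightarrow> (real \<Rightarrow> 'a) \<Rightarrow> 'a \<Rightarrow> bool" where
  "invertible_curve u u' x \<longleftrightarrow>
     (\<forall>t. u differentiable (at t) \<and> u t * u' t = 1 \<and> u' t * u t = 1) \<and>
     u 0 = 1 \<and> (u has_vector_derivative x) (at 0)"

lemma invertible_curve_inverse_0: "invertible_curve u u' x \<Longrightarrow> u' 0 = 1"
  unfolding invertible_curve_def by (metis mult_1)

lemma invertible_curve_differentiable_inverse:
  "invertible_curve u u' x \<Longrightarrow> u' differentiable (at t)"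
  unfolding invertible_curve_def using differentiable_inverse_curve by blast

text \<open>
  Since \<open>1 = v u u' v'\<close>, the commutator minus 1 is \<open>(u v - v u) u' v'\<close>, and \<open>u v - v u\<close> does not change
  when 1 is subtracted from both factors. Each of \<open>u - 1\<close> and \<open>v - 1\<close> absorbs one factor \<open>s\<close>, so
  differentiability of first order yields an expansion of second order.
\<close>
lemma commutator_second_order:
  assumes u: "invertible_curve u u' x" and v: "invertible_curve v v' y"
  shows "((\<lambda>s. (u s * v s * u' s * v' s - 1) /\<^sub>R s\<^sup>2) \<longlongrightarrow> x * y - y * x) (at 0)"
proof -
  define p where "p s = (u s - 1) /\<^sub>R s" for s
  define q where "q s = (v s - 1) /\<^sub>R s" for s
  have p: "(p \<longlongrightarrow> x) (at 0)" and q: "(q \<longlongrightarrow> y) (at 0)"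
    using u v unfolding invertible_curve_def has_vector_derivative_iff_quotient p_def q_def by auto
  have u': "(u' \<longlongrightarrow> 1) (at 0)" and v': "(v' \<longlongrightarrow> 1) (at 0)"
    using invertible_curve_differentiable_inverse[OF u, of 0]
      invertible_curve_differentiable_inverse[OF v, of 0]
      invertible_curve_inverse_0[OF u] invertible_curve_inverse_0[OF v]
      differentiable_imp_continuous_within[of u' 0 UNIV] differentiable_imp_continuous_within[of v' 0 UNIV]
    by (simp_all add: isCont_def)
  have "(u s * v s * u' s * v' s - 1) /\<^sub>R s\<^sup>2 = (p s * q s - q s * p s) * (u' s * v' s)" for s
  proof -
    have "v s * u s * (u' s * v' s) = v s * (u s * u' s) * v' s"
      by (simp only: mult.assoc)
    also have "\<dots> = 1"
      using u v by (simp add: invertible_curve_def)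
    finally have "u s * v s * u' s * v' s - 1 = (u s * v s - v s * u s) * (u' s * v' s)"
      by (simp add: left_diff_distrib mult.assoc)
    moreover have "u s * v s - v s * u s = (u s - 1) * (v s - 1) - (v s - 1) * (u s - 1)"
      by (simp add: algebra_simps)
    moreover have "p s * q s = ((u s - 1) * (v s - 1)) /\<^sub>R s\<^sup>2" "q s * p s = ((v s - 1) * (u s - 1)) /\<^sub>R s\<^sup>2"
      by (simp_all add: p_def q_def power2_eq_square)
    then have "p s * q s - q s * p s = ((u s - 1) * (v s - 1) - (v s - 1) * (u s - 1)) /\<^sub>R s\<^sup>2"
      by (simp only: scaleR_right_diff_distrib)
    ultimately show ?thesis by simp
  qed
  moreover have "((\<lambda>s. (p s * q s - q s * p s) * (u' s * v' s)) \<longlongrightarrow> (x * y - y * x) * (1 * 1)) (at 0)"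
    by (intro tendsto_intros p q u' v')
  ultimately show ?thesis by simp
qed

section \<open>The tangent space\<close>

lemma tangent_spaceI:
  assumes "\<And>t. a t \<in> G" "\<And>t. a differentiable (at t)" "a 0 = 1" "(a has_vector_derivative x) (at 0)"
  shows "x \<in> tangent_space_1 G"
  unfolding tangent_space_1_def using assms vector_derivative_at[OF assms(4)] by blast

lemma tangent_spaceE:
  assumes "x \<in> tangent_space_1 G"
  obtains a where "\<And>t. a t \<in> G" "\<And>t. a differentiable (at t)" "a 0 = 1"
    "(a has_vector_derivative x) (at 0)"
proof -
  obtain a where "x = vector_derivative a (at 0)" "range a \<subseteq> G" "\<forall>t. a differentiable (at t)" "a 0 = 1"
    using assms unfolding tangent_space_1_def by blast
  then show ?thesis
    using that[of a] by (auto simp: vector_derivative_works)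
qed

text \<open>
  Curves leaving 1 quadratically in opposite directions are joined to one curve with velocity \<open>z\<close>.
  The square root turns second order into first order; away from 0 it is differentiable, and at 0
  the one-sided difference quotients become the two given quotients,
  the left one with its sign reversed.
\<close>
lemma tangent_square_root_reparametrisation:
  fixes f g :: "real \<Rightarrow> 'a::{real_normed_algebra,monoid_mult}"
  assumes in_G: "\<And>s. f s \<in> G" "\<And>s. g s \<in> G"
    and diff: "\<And>s. f differentiable (at s)" "\<And>s. g differentiable (at s)"
    and at_0: "f 0 = 1"
    and lim: "((\<lambda>s. (f s - 1) /\<^sub>R s\<^sup>2) \<longlongrightarrow> z) (at 0)" "((\<lambda>s. (g s - 1) /\<^sub>R s\<^sup>2) \<longlongrightarrow> - z) (at 0)"
  shows "z \<in> tangent_space_1 G"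
proof -
  define c where "c t = (if t \<ge> 0 then f (sqrt t) else g (sqrt (- t)))" for t
  have pos: "c differentiable (at t)" if "t > 0" for t
  proof -
    have "sqrt differentiable (at t)"
      using DERIV_real_sqrt[OF that] real_differentiable_def by blast
    then have "(f \<circ> sqrt) differentiable (at t)"
      using diff(1) by (intro differentiable_chain_at)
    then have "(f \<circ> sqrt has_vector_derivative vector_derivative (f \<circ> sqrt) (at t)) (at t)"
      by (simp add: vector_derivative_works)
    then have "(c has_vector_derivative vector_derivative (f \<circ> sqrt) (at t)) (at t)"
      by (rule has_vector_derivative_transform_within_open[of _ _ _ "{0<..}"]) (use that in \<open>auto simp: c_def\<close>)
    then show ?thesis by (rule differentiableI_vector)
  qed
  have neg: "c differentiable (at t)" if "t < 0" for t
  proof -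
    have "((\<lambda>t. sqrt (- t)) has_real_derivative - (inverse (sqrt (- t)) / 2)) (at t)"
      using that by (auto intro!: derivative_eq_intros)
    then have "(\<lambda>t. sqrt (- t)) differentiable (at t)"
      using real_differentiable_def by blast
    then have "(g \<circ> (\<lambda>t. sqrt (- t))) differentiable (at t)"
      using diff(2) by (intro differentiable_chain_at)
    then have "(g \<circ> (\<lambda>t. sqrt (- t)) has_vector_derivative vector_derivative (g \<circ> (\<lambda>t. sqrt (- t))) (at t)) (at t)"
      by (simp add: vector_derivative_works)
    then have "(c has_vector_derivative vector_derivative (g \<circ> (\<lambda>t. sqrt (- t))) (at t)) (at t)"
      by (rule has_vector_derivative_transform_within_open[of _ _ _ "{..<0}"]) (use that in \<open>auto simp: c_def\<close>)
    then show ?thesis by (rule differentiableI_vector)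
  qed
  have sqrt_right: "filterlim sqrt (at 0) (at_right 0)"
    unfolding filterlim_at
    using tendsto_real_sqrt[OF tendsto_ident_at, of 0 "{0<..}"] by (auto simp: eventually_at_filter)
  have sqrt_left: "filterlim (\<lambda>t. sqrt (- t)) (at 0) (at_left 0)"
    unfolding filterlim_at
    using tendsto_real_sqrt[OF tendsto_minus[OF tendsto_ident_at], of 0 "{..<0}"]
    by (auto simp: eventually_at_filter)
  have "((\<lambda>t. (c t - 1) /\<^sub>R t) \<longlongrightarrow> z) (at_right 0)"
  proof (rule Lim_transform_eventually)
    show "((\<lambda>t. (f (sqrt t) - 1) /\<^sub>R (sqrt t)\<^sup>2) \<longlongrightarrow> z) (at_right 0)"
      using filterlim_compose[OF lim(1) sqrt_right] .
  qed (auto simp: eventually_at_filter c_def)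
  moreover have "((\<lambda>t. (c t - 1) /\<^sub>R t) \<longlongrightarrow> z) (at_left 0)"
  proof (rule Lim_transform_eventually)
    show "((\<lambda>t. - ((g (sqrt (- t)) - 1) /\<^sub>R (sqrt (- t))\<^sup>2)) \<longlongrightarrow> z) (at_left 0)"
      using tendsto_minus[OF filterlim_compose[OF lim(2) sqrt_left]] by simp
  qed (auto simp: eventually_at_filter c_def)
  ultimately have "((\<lambda>t. (c t - 1) /\<^sub>R t) \<longlongrightarrow> z) (at 0)"
    by (rule filterlim_split_at[rotated])
  then have c_0: "(c has_vector_derivative z) (at 0)"
    by (simp add: has_vector_derivative_iff_quotient c_def at_0)
  have "c differentiable (at t)" for t
    using pos[of t] neg[of t] differentiableI_vector[OF c_0] by (cases t "0 :: real" rule: linorder_cases) auto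
  then show ?thesis
    using c_0 by (intro tangent_spaceI[of c]) (auto simp: c_def in_G at_0)
qed

text \<open>
  Only the two commutators have to lie in \<open>G\<close>, not the curves themselves. The angle bracket depends
  on this freedom.
\<close>
lemma tangent_commutator:
  assumes u: "invertible_curve u u' x" and v: "invertible_curve v v' y"
    and in_G: "\<And>t. u t * v t * u' t * v' t \<in> G" "\<And>t. v t * u t * v' t * u' t \<in> G"
  shows "x * y - y * x \<in> tangent_space_1 G"
proof (rule tangent_square_root_reparametrisation)
  have *: "u differentiable (at t)" "v differentiable (at t)" "u' differentiable (at t)" "v' differentiable (at t)" for t
    using u v invertible_curve_differentiable_inverse[OF u] invertible_curve_differentiable_inverse[OF v]
    by (simp_all add: invertible_curve_def)
  show "(\<lambda>t. u t * v t * u' t * v' t) differentiable (at t)"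
    "(\<lambda>t. v t * u t * v' t * u' t) differentiable (at t)" for t
    by (intro differentiable_mult *)+
  show "u 0 * v 0 * u' 0 * v' 0 = 1"
    using u v invertible_curve_inverse_0[OF u] invertible_curve_inverse_0[OF v]
    by (simp add: invertible_curve_def)
  show "((\<lambda>s. (u s * v s * u' s * v' s - 1) /\<^sub>R s\<^sup>2) \<longlongrightarrow> x * y - y * x) (at 0)"
    using commutator_second_order[OF u v] .
  show "((\<lambda>s. (v s * u s * v' s * u' s - 1) /\<^sub>R s\<^sup>2) \<longlongrightarrow> - (x * y - y * x)) (at 0)"
    using commutator_second_order[OF v u] by simp
qed (fact in_G)+

lemma inv_group_simps:
  "carrier inv_group = Units \<lparr>carrier = UNIV, monoid.mult = (*), one = 1\<rparr>"
  "x \<otimes>\<^bsub>inv_group\<^esub> y = x * y" "\<one>\<^bsub>inv_group\<^esub> = 1"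
  by (simp_all add: inv_group_def units_of_def)

lemma group_inv_group: "group (inv_group :: 'a::monoid_mult monoid)"
  unfolding inv_group_def
  by (intro monoid.units_group monoidI) (auto simp: mult.assoc)

lemma inv_group_inv_eq:
  fixes x y :: "'a::monoid_mult"
  assumes "x * y = 1" "y * x = 1"
  shows "m_inv inv_group x = y"
proof -
  have "x \<in> carrier inv_group" "y \<in> carrier inv_group"
    using assms by (auto simp: inv_group_simps Units_def)
  then show ?thesis
    using assms group.inv_equality[OF group_inv_group, of y x] by (simp add: inv_group_simps)
qed

lemma subgroup_inv_group:
  fixes G :: "'a::monoid_mult set"
  assumes "subgroup G inv_group"
  shows "1 \<in> G" "x \<in> G \<Longrightarrow> y \<in> G \<Longrightarrow> x * y \<in> G"
    "x \<in> G \<Longrightarrow> \<exists>y\<in>G. x * y = 1 \<and> y * x = 1"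
proof -
  show "1 \<in> G"
    using subgroup.one_closed[OF assms] by (simp add: inv_group_simps)
  show "x * y \<in> G" if "x \<in> G" "y \<in> G" 
    using subgroup.m_closed[OF assms that] by (simp add: inv_group_simps)
  show "\<exists>y\<in>G. x * y = 1 \<and> y * x = 1" if "x \<in> G"
    using subgroup.m_inv_closed[OF assms that] subgroup.mem_carrier[OF assms that]
      group.r_inv[OF group_inv_group, of x] group.l_inv[OF group_inv_group, of x]
    by (auto simp: inv_group_simps)
qed

lemma subspace_tangent_space:
  fixes G :: "'a::{real_normed_algebra,monoid_mult} set"
  assumes "subgroup G inv_group"
  shows "subspace (tangent_space_1 G)"
proof (rule subspaceI)
  note G = subgroup_inv_group[OF assms]
  show "0 \<in> tangent_space_1 G"
    by (rule tangent_spaceI[of "\<lambda>_. 1"]) (auto simp: G)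
  fix x assume "x \<in> tangent_space_1 G"
  then obtain a where a: "\<And>t. a t \<in> G" "\<And>t. a differentiable (at t)" "a 0 = 1"
    "(a has_vector_derivative x) (at 0)" by (rule tangent_spaceE) blast
  show "x + y \<in> tangent_space_1 G" if y: "y \<in> tangent_space_1 G" for y
  proof -
    obtain b where b: "\<And>t. b t \<in> G" "\<And>t. b differentiable (at t)" "b 0 = 1"
      "(b has_vector_derivative y) (at 0)" using y by (rule tangent_spaceE) blast
    show ?thesis
    proof (rule tangent_spaceI[of "\<lambda>t. a t * b t"])
      show "((\<lambda>t. a t * b t) has_vector_derivative x + y) (at 0)"
        using has_vector_derivative_mult[OF a(4) b(4)] a(3) b(3) by (simp add: add.commute)
    qed (use a b G in \<open>auto intro: differentiable_mult\<close>)
  qed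
  show "c *\<^sub>R x \<in> tangent_space_1 G" for c
  proof (rule tangent_spaceI[of "a \<circ> (\<lambda>t. c * t)"])
    have "((\<lambda>t. c * t) has_vector_derivative c) (at t)" for t
      by (auto intro!: derivative_eq_intros simp: has_real_derivative_iff_has_vector_derivative[symmetric])
    then show "(a \<circ> (\<lambda>t. c * t) has_vector_derivative c *\<^sub>R x) (at 0)"
      using a(4) by (intro vector_diff_chain_at) auto
    show "a \<circ> (\<lambda>t. c * t) differentiable (at t)" for t
      by (intro differentiable_chain_at a(2)) auto
  qed (auto simp: a)
qed

lemma tangent_square_bracket:
  fixes G :: "'a::{real_normed_algebra,monoid_mult} set"
  assumes "subgroup G inv_group" "x \<in> tangent_space_1 G" "y \<in> tangent_space_1 G"
  shows "square_bracket x y \<in> tangent_space_1 G"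
proof -
  note G = subgroup_inv_group[OF assms(1)]
  obtain a where a: "\<And>t. a t \<in> G" "\<And>t. a differentiable (at t)" "a 0 = 1"
    "(a has_vector_derivative x) (at 0)" using assms(2) by (rule tangent_spaceE) blast
  obtain b where b: "\<And>t. b t \<in> G" "\<And>t. b differentiable (at t)" "b 0 = 1"
    "(b has_vector_derivative y) (at 0)" using assms(3) by (rule tangent_spaceE) blast
  obtain i where i: "\<And>g. g \<in> G \<Longrightarrow> i g \<in> G \<and> g * i g = 1 \<and> i g * g = 1"
    using G(3) by metis
  show ?thesis
    unfolding square_bracket_def
  proof (rule tangent_commutator)
    show "invertible_curve a (\<lambda>t. i (a t)) x" "invertible_curve b (\<lambda>t. i (b t)) y"
      by (simp_all add: invertible_curve_def a b i)
  qed (auto intro!: G(2) a b simp: i a b)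
qed

context special_graded_banach_algebra
begin

text \<open>
  The odd part \<open>f\<close> of the identity vanishes: \<open>f = 1 * f\<close>, and both \<open>ev 1 * f\<close> and \<open>f * f\<close> are zero.
\<close>
lemma even_part_one: "ev 1 = 1"
proof -
  have "ev 1 * (1 - ev 1) = 0"
    using even_part_mult[of 1 "ev 1"] by (simp add: right_diff_distrib even_part_mult[symmetric])
  then show ?thesis
    using odd_mult_odd[of 1 1] by (simp add: algebra_simps)
qed

lemma even_part_inverse:
  assumes "x * y = 1"
  shows "ev x * ev y = 1"
  using assms even_part_mult[of x y] even_part_one by simp

text \<open>
  The inverse in the definition of a linear \<open>\<xi>\<close>-group is taken in the unit group of \<open>A\<close>. For the even
  part of a unit it is the even part of the inverse, because the even part is a unital homomorphism.
\<close>
lemma linear_xi_group_conj: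
  assumes G: "linear_xi_group A0 A1 G" and "x \<in> G" "g \<in> G" and inv: "x * y = 1" "y * x = 1"
  shows "ev x * g * ev y \<in> G"
proof -
  have "ev x + (x - ev x) \<in> G" using \<open>x \<in> G\<close> by simp
  then have "ev x * g * m_inv inv_group (ev x) \<in> G"
    using G even_part_in[of x] odd_part_in[of x] \<open>g \<in> G\<close> unfolding linear_xi_group_def by blast
  then show ?thesis
    by (simp add: inv_group_inv_eq[OF even_part_inverse[OF inv(1)] even_part_inverse[OF inv(2)]])
qed

lemma tangent_angle_bracket:
  assumes xi: "linear_xi_group A0 A1 G"
    and x: "x \<in> tangent_space_1 G" and y: "y \<in> tangent_space_1 G"
  shows "angle_bracket A0 A1 x y \<in> tangent_space_1 G"
proof -
  have "subgroup G inv_group" using xi by (simp add: linear_xi_group_def)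
  note G = subgroup_inv_group[OF this]
  obtain a where a: "\<And>t. a t \<in> G" "\<And>t. a differentiable (at t)" "a 0 = 1"
    "(a has_vector_derivative x) (at 0)" using x by (rule tangent_spaceE) blast
  obtain b where b: "\<And>t. b t \<in> G" "\<And>t. b differentiable (at t)" "b 0 = 1"
    "(b has_vector_derivative y) (at 0)" using y by (rule tangent_spaceE) blast
  obtain i where i: "\<And>g. g \<in> G \<Longrightarrow> i g \<in> G \<and> g * i g = 1 \<and> i g * g = 1"
    using G(3) by metis
  have conj: "ev (b t) * g * ev (i (b t)) \<in> G" if "g \<in> G" for g t
    using linear_xi_group_conj[OF xi b(1) that] i[OF b(1)] by blast
  show ?thesis
    unfolding angle_bracket_def
  proof (rule tangent_commutator)
    show "invertible_curve a (\<lambda>t. i (a t)) x"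
      by (simp add: invertible_curve_def a i)
    have "(\<lambda>t. ev (b t)) differentiable (at t)" for t
    proof (rule differentiableI_vector)
      show "((\<lambda>t. ev (b t)) has_vector_derivative ev (vector_derivative b (at t))) (at t)"
        using b(2)[of t] unfolding vector_derivative_works
        by (rule bounded_linear.has_vector_derivative[OF bounded_linear_even_part])
    qed
    then show "invertible_curve (\<lambda>t. ev (b t)) (\<lambda>t. ev (i (b t))) (ev y)"
      using bounded_linear.has_vector_derivative[OF bounded_linear_even_part b(4)]
      by (simp add: invertible_curve_def even_part_inverse even_part_one b i)
    show "a t * ev (b t) * i (a t) * ev (i (b t)) \<in> G" for t
      using G(2)[OF a(1) conj[of "i (a t)" t], of t] i[OF a(1)] by (simp add: mult.assoc)
    show "ev (b t) * a t * ev (i (b t)) * i (a t) \<in> G" for t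
      using G(2)[OF conj[OF a(1), of t t], of "i (a t)"] i[OF a(1)] by simp
  qed
qed

text \<open>
  The even part is linear over the reals whatever the scalar field is, so real and complex algebras
  are treated alike.
\<close>
theorem hu_liu_tangent_space:
  assumes "linear_xi_group A0 A1 G"
  shows "hu_liu_leibniz_algebra_on ((*\<^sub>R) :: real \<Rightarrow> 'a \<Rightarrow> 'a) (tangent_space_1 G)
           (angle_bracket A0 A1) square_bracket"
proof -
  have G: "subgroup G inv_group" using assms by (simp add: linear_xi_group_def)
  have sc: "ev (c *\<^sub>R x) = c *\<^sub>R ev x" for c x
    using even_part_scale[of "of_real c"] by (simp add: scale_of_real)
  show ?thesis
  proof
    show "Modules.module.subspace ((*\<^sub>R) :: real \<Rightarrow> 'a \<Rightarrow> 'a) (tangent_space_1 G)"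
      using subspace_tangent_space[OF G] by (simp only: subspace_raw_def)
  qed (rule angle_right_leibniz angle_square square_angle_self angle_derivation_square square_angle_mixed
      | (rule tangent_angle_bracket[OF assms] tangent_square_bracket[OF G]; assumption)
      | simp add: angle_bracket_def square_bracket_def even_part_add sc algebra_simps)+
qed

end

theorem proposition3p1:
  fixes A0 A1 G :: "'a::{real_normed_algebra,monoid_mult,banach} set"
  assumes "special_graded_banach_algebra ((*\<^sub>R) :: real \<Rightarrow> 'a \<Rightarrow> 'a) A0 A1 \<or>
           (\<exists>scaleC :: complex \<Rightarrow> 'a \<Rightarrow> 'a. special_graded_banach_algebra scaleC A0 A1)"
    and "linear_xi_group A0 A1 G"
  shows "hu_liu_leibniz_algebra_on ((*\<^sub>R) :: real \<Rightarrow> 'a \<Rightarrow> 'a) (tangent_space_1 G)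
           (angle_bracket A0 A1) square_bracket"
  using assms(1)
proof (elim disjE exE)
  assume "special_graded_banach_algebra ((*\<^sub>R) :: real \<Rightarrow> 'a \<Rightarrow> 'a) A0 A1"
  then show ?thesis
    using assms(2) by (rule special_graded_banach_algebra.hu_liu_tangent_space)
next
  fix scaleC :: "complex \<Rightarrow> 'a \<Rightarrow> 'a"
  assume "special_graded_banach_algebra scaleC A0 A1"
  then show ?thesis
    using assms(2) by (rule special_graded_banach_algebra.hu_liu_tangent_space)
qed

end
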